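(* Let $(V,d)$ be a bounded closed Hilbert complex and $(V_h,d)$ a subcomplex. Assume that $$\|v\|_V\le c_1\|dv\|_V,\quad v\in\mathfrak Z_h^{k\perp},\qquad\text{and}\qquad\|q\|_V\le c_2\|P_{\mathfrak H}q\|_V,\quad q\in\mathfrak H_h^k,$$ for some constants $c_1$ and $c_2$ (for each form degree $k$). Then there exists a bounded cochain projection $\pi_h$ from $(V,d)$ to $(V_h,d)$, and the $V$ operator norm $\|\pi_h\|$ can be bounded in terms of $c_1$ and $c_2$.
   Context: A bounded closed Hilbert complex $(V,d)$ is a finite sequence of real Hilbert spaces $V^k$ and bounded linear operators $d^k:V^k\to V^{k+1}$ with $d^{k+1}\circ d^k=0$ such that the range of each $d^k$ is closed in $V^{k+1}$. The norm of $V^k$ is written $\|\cdot\|_V$, and $d$ is written for $d^k$. Set $\mathfrak Z^k=\ker d^k$, $\mathfrak B^k=d^{k-1}V^{k-1}$, $\mathfrak H^k=\mathfrak Z^k\cap(\mathfrak B^k)^\perp$ (harmonic forms), and let $P_{\mathfrak H}$ be the orthogonal projection onto $\mathfrak H^k$. The subcomplex $(V_h,d)$ consists of finite-dimensional subspaces $V_h^k\subset V^k$ with $d^kV_h^k\subset V_h^{k+1}$, with the inherited inner product and differential; $\mathfrak Z_h^k=\ker(d^k|_{V_h^k})$, $\mathfrak B_h^k=d^{k-1}V_h^{k-1}$, $\mathfrak H_h^k=\mathfrak Z_h^k\cap(\mathfrak B_h^k)^\perp$, and $\mathfrak Z_h^{k\perp}$ is the orthogonal complement of $\mathfrak Z_h^k$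 in $V_h^k$. A bounded cochain projection $\pi_h$ is a collection of bounded linear maps $\pi_h^k:V^k\to V_h^k$ which restrict to the identity on $V_h^k$ and satisfy $d^k\pi_h^k=\pi_h^{k+1}d^k$.
   Formalization: The bound on the operator norm of the projection depends on c_1, c_2 and also on an upper bound M for the norms of the differentials d^k; a bound by c_1 and c_2 alone, uniform over all bounded closed Hilbert complexes, is false (M = 1 covers graph norms). *)

theory Defs
  imports "HOL-Analysis.Analysis"
begin

text \<open>
  The spaces of a complex are complete linear subspaces of one inner product space, indexed by
  the integers and equal to zero outside finitely many degrees. Nothing is assumed about the
  position of the spaces of different degrees relative to each other, so any finite sequence of
  Hilbert spaces is covered (embed it in its orthogonal direct sum). The map \<open>d k\<close> is only
  meaningful on \<open>V k\<close>; its values elsewhere are irrelevant.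
\<close>

definition bounded_linear_on ::
  "'a::real_normed_vector set \<Rightarrow> ('a \<Rightarrow> 'b::real_normed_vector) \<Rightarrow> bool" where
  "bounded_linear_on S f \<longleftrightarrow>
     (\<forall>x\<in>S. \<forall>y\<in>S. f (x + y) = f x + f y) \<and>
     (\<forall>r. \<forall>x\<in>S. f (r *\<^sub>R x) = r *\<^sub>R f x) \<and>
     (\<exists>K. \<forall>x\<in>S. norm (f x) \<le> norm x * K)"

text \<open>
  The analogue of \<^const>\<open>onorm\<close> for an operator defined on a subspace. It is only meaningful
  for operators that are bounded on \<open>S\<close>.
\<close>

definition onorm_on ::
  "'a::real_normed_vector set \<Rightarrow> ('a \<Rightarrow> 'b::real_normed_vector) \<Rightarrow> real" where
  "onorm_on S f = (SUP x\<in>S. norm (f x) / norm x)"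

definition orth_proj :: "'a::real_inner set \<Rightarrow> 'a \<Rightarrow> 'a" where
  "orth_proj S x = (THE p. p \<in> S \<and> x - p \<in> S\<^sup>\<bottom>)"

definition cocycles :: "(int \<Rightarrow> 'a \<Rightarrow> 'a::real_inner) \<Rightarrow> (int \<Rightarrow> 'a set) \<Rightarrow> int \<Rightarrow> 'a set" where
  "cocycles d V k = {v \<in> V k. d k v = 0}"

definition coboundaries :: "(int \<Rightarrow> 'a \<Rightarrow> 'a::real_inner) \<Rightarrow> (int \<Rightarrow> 'a set) \<Rightarrow> int \<Rightarrow> 'a set" where
  "coboundaries d V k = d (k - 1) ` V (k - 1)"

definition harmonics :: "(int \<Rightarrow> 'a \<Rightarrow> 'a::real_inner) \<Rightarrow> (int \<Rightarrow> 'a set) \<Rightarrow> int \<Rightarrow> 'a set" where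
  "harmonics d V k = cocycles d V k \<inter> (coboundaries d V k)\<^sup>\<bottom>"

definition cocycles_perp :: "(int \<Rightarrow> 'a \<Rightarrow> 'a::real_inner) \<Rightarrow> (int \<Rightarrow> 'a set) \<Rightarrow> int \<Rightarrow> 'a set" where
  "cocycles_perp d V k = V k \<inter> (cocycles d V k)\<^sup>\<bottom>"

definition bounded_closed_hilbert_complex ::
  "(int \<Rightarrow> 'a \<Rightarrow> 'a::real_inner) \<Rightarrow> (int \<Rightarrow> 'a set) \<Rightarrow> bool" where
  "bounded_closed_hilbert_complex d V \<longleftrightarrow>
     finite {k. V k \<noteq> {0}} \<and>
     (\<forall>k. subspace (V k) \<and> complete (V k)) \<and>
     (\<forall>k. d k ` V k \<subseteq> V (k + 1) \<and> bounded_linear_on (V k) (d k)) \<and>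
     (\<forall>k. \<forall>v\<in>V k. d (k + 1) (d k v) = 0) \<and>
     (\<forall>k. closedin (top_of_set (V (k + 1))) (d k ` V k))"

definition finite_dim_subcomplex ::
  "(int \<Rightarrow> 'a \<Rightarrow> 'a::real_inner) \<Rightarrow> (int \<Rightarrow> 'a set) \<Rightarrow> (int \<Rightarrow> 'a set) \<Rightarrow> bool" where
  "finite_dim_subcomplex d V Vh \<longleftrightarrow>
     (\<forall>k. (\<exists>B. finite B \<and> span B = Vh k) \<and> Vh k \<subseteq> V k \<and> d k ` Vh k \<subseteq> Vh (k + 1))"

definition bounded_cochain_projection ::
  "(int \<Rightarrow> 'a \<Rightarrow> 'a::real_inner) \<Rightarrow> (int \<Rightarrow> 'a set) \<Rightarrow> (int \<Rightarrow> 'a set) \<Rightarrow> (int \<Rightarrow> 'a \<Rightarrow> 'a) \<Rightarrow> bool" where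
  "bounded_cochain_projection d V Vh \<pi> \<longleftrightarrow>
     (\<forall>k. bounded_linear_on (V k) (\<pi> k) \<and> \<pi> k ` V k \<subseteq> Vh k) \<and>
     (\<forall>k. \<forall>v\<in>Vh k. \<pi> k v = v) \<and>
     (\<forall>k. \<forall>v\<in>V k. d k (\<pi> k v) = \<pi> (k + 1) (d k v))"

end

theory Submission
  imports Defs
begin

text \<open>
  Inverting \<open>d\<close> on the discrete \<open>\<ZZ>\<^sub>h\<^sup>\<bottom>\<close> after projecting orthogonally onto \<open>\<BB>\<^sub>h\<close> gives an operator
  \<open>Q v \<in> \<ZZ>\<^sub>h\<^sup>\<bottom>\<close> with \<open>d (Q v) = P\<^sub>\<BB>\<^sub>h (d v)\<close> and norm at most \<open>c1 \<parallel>d\<parallel>\<close>. Inverting the projection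
  \<open>P\<^sub>\<HH>\<close> on \<open>\<HH>\<^sub>h\<close> after projecting orthogonally onto \<open>P\<^sub>\<HH> \<HH>\<^sub>h\<close> gives an operator \<open>R\<close> into \<open>\<HH>\<^sub>h\<close> with
  norm at most \<open>c2\<close>, which fixes \<open>\<HH>\<^sub>h\<close> and vanishes on \<open>\<BB>\<close>. The cochain projection is
  \<open>\<pi> v = Q v + (P\<^sub>\<BB>\<^sub>h + R) (v - Q v)\<close>: it reduces to \<open>P\<^sub>\<BB>\<^sub>h\<close> on \<open>\<BB>\<close>, which makes it commute with \<open>d\<close>,
  and on \<open>V\<^sub>h\<close> the three terms are the components of the discrete Hodge decomposition.
\<close>

section \<open>Orthogonal projections\<close>

text \<open>The ambient space may be incomplete, so orthogonal projections can fail to exist. This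
  predicate guarantees that the description in \<open>orth_proj\<close> denotes; finite spans and
  complete subspaces satisfy it.\<close>

definition orth_complemented :: "'a::real_inner set \<Rightarrow> bool" where
  "orth_complemented S \<longleftrightarrow> subspace S \<and> (\<forall>x. \<exists>p\<in>S. x - p \<in> S\<^sup>\<bottom>)"

lemma mem_orthogonal_comp_iff: "x \<in> S\<^sup>\<bottom> \<longleftrightarrow> (\<forall>y\<in>S. y \<bullet> x = 0)"
  by (simp add: orthogonal_comp_def orthogonal_def)

text \<open>Two candidates differ by an element of \<open>S \<inter> S\<^sup>\<bottom>\<close>,
  which is zero.\<close>

lemma orth_proj_eqI:
  assumes "subspace S" "p \<in> S" "x - p \<in> S\<^sup>\<bottom>"
  shows "orth_proj S x = p"
  unfolding orth_proj_def
proof (rule the_equality)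
  fix q assume q: "q \<in> S \<and> x - q \<in> S\<^sup>\<bottom>"
  then have "(x - q) - (x - p) \<in> S\<^sup>\<bottom>"
    using assms(3) by (simp only: subspace_diff[OF subspace_orthogonal_comp])
  then have "p - q \<in> S\<^sup>\<bottom>" by simp
  moreover have "p - q \<in> S" using q assms(1,2) by (simp add: subspace_diff)
  ultimately have "p - q \<in> {0}" unfolding orthogonal_Int_0[OF assms(1), symmetric] by simp
  then show "q = p" by simp
qed (use assms in auto)

lemma orth_proj:
  assumes "orth_complemented S"
  shows orth_proj_in: "orth_proj S x \<in> S"
    and orth_proj_diff: "x - orth_proj S x \<in> S\<^sup>\<bottom>"
proof -
  obtain p where "p \<in> S" "x - p \<in> S\<^sup>\<bottom>"
    using assms unfolding orth_complemented_def by blast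
  moreover from this have "orth_proj S x = p"
    using assms by (intro orth_proj_eqI) (simp_all add: orth_complemented_def)
  ultimately show "orth_proj S x \<in> S" "x - orth_proj S x \<in> S\<^sup>\<bottom>" by simp_all
qed

lemma orth_proj_id:
  assumes "subspace S" "x \<in> S"
  shows "orth_proj S x = x"
  using assms by (intro orth_proj_eqI) (auto simp: subspace_0 subspace_orthogonal_comp)

lemma orth_proj_comp:
  assumes "subspace S" "x \<in> S\<^sup>\<bottom>"
  shows "orth_proj S x = 0"
  using assms by (intro orth_proj_eqI) (auto simp: subspace_0)

lemma linear_orth_proj:
  assumes "orth_complemented S"
  shows "linear (orth_proj S)"
proof (rule linearI)
  have S: "subspace S" using assms by (simp add: orth_complemented_def)
  fix x y :: 'a and r :: real
  have "(x - orth_proj S x) + (y - orth_proj S y) \<in> S\<^sup>\<bottom>"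
    by (intro subspace_add subspace_orthogonal_comp orth_proj_diff assms)
  then show "orth_proj S (x + y) = orth_proj S x + orth_proj S y"
    using S orth_proj_in[OF assms] by (intro orth_proj_eqI) (auto simp: subspace_add algebra_simps)
  have "r *\<^sub>R (x - orth_proj S x) \<in> S\<^sup>\<bottom>"
    by (intro subspace_scale subspace_orthogonal_comp orth_proj_diff assms)
  then show "orth_proj S (r *\<^sub>R x) = r *\<^sub>R orth_proj S x"
    using S orth_proj_in[OF assms]
    by (intro orth_proj_eqI) (auto simp: subspace_scale algebra_simps)
qed

lemma norm_orth_proj_le:
  assumes "orth_complemented S"
  shows "norm (orth_proj S x) \<le> norm x"
proof -
  let ?p = "orth_proj S x"
  have "?p \<bullet> (x - ?p) = 0"
    using orth_proj[OF assms] mem_orthogonal_comp_iff by blast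
  then have "(norm ?p)\<^sup>2 = ?p \<bullet> x" by (simp add: power2_norm_eq_inner inner_diff_right)
  also have "\<dots> \<le> norm ?p * norm x" by (rule norm_cauchy_schwarz)
  finally have "norm ?p * norm ?p \<le> norm ?p * norm x" by (simp add: power2_eq_square)
  then show ?thesis by (cases "norm ?p = 0") auto
qed

lemma orth_complemented_span:
  assumes "finite B"
  shows "orth_complemented (span B)"
proof -
  obtain C where C: "finite C" "span C = span B" "pairwise orthogonal C"
    using basis_orthogonal[OF assms] by blast
  have "\<exists>p\<in>span C. x - p \<in> (span C)\<^sup>\<bottom>" for x
  proof (intro bexI)
    \<comment> \<open>Fourier expansion along the orthogonal set \<open>C\<close>. If 0 lies in
      \<open>C\<close>, division by zero gives it coefficient 0, and the computation below still
      holds.\<close>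
    let ?p = "\<Sum>b\<in>C. (b \<bullet> x / (b \<bullet> b)) *\<^sub>R b"
    show "?p \<in> span C" by (intro span_sum span_scale span_base)
    have "orthogonal (x - ?p) c" if c: "c \<in> C" for c
    proof -
      have "?p \<bullet> c = (\<Sum>b\<in>C. (b \<bullet> x / (b \<bullet> b)) * (b \<bullet> c))" by (simp add: inner_sum_left)
      also have "\<dots> = (\<Sum>b\<in>C. if b = c then c \<bullet> x else 0)"
        using C(3) c by (intro sum.cong) (auto simp: pairwise_def orthogonal_def)
      also have "\<dots> = c \<bullet> x" using C(1) c by simp
      finally show ?thesis by (simp add: orthogonal_def inner_diff_left inner_commute[of x])
    qed
    then show "x - ?p \<in> (span C)\<^sup>\<bottom>"
      unfolding orthogonal_comp_def using orthogonal_to_span orthogonal_commute by blast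
  qed
  then show ?thesis using C(2) by (auto simp: orth_complemented_def)
qed

text \<open>A basis of \<open>S\<close> is an independent set inside a finitely spanned space, hence
  finite.\<close>

lemma subspace_finite_span:
  fixes S :: "'a::real_vector set"
  assumes "subspace S" "S \<subseteq> span B" "finite B"
  obtains C where "finite C" "span C = S"
  by (metis assms basis_exists dual_order.trans independent_span_bound span_subspace)

text \<open>The projection theorem: a minimizing sequence is Cauchy by the parallelogram law.\<close>

lemma orth_complemented_complete:
  fixes S :: "'a::real_inner set"
  assumes S: "subspace S" and comp: "complete S"
  shows "orth_complemented S"
  unfolding orth_complemented_def
proof (intro conjI allI S)
  fix x
  define D where "D = (INF y\<in>S. (norm (x - y))\<^sup>2)"
  have bdd: "bdd_below ((\<lambda>y. (norm (x - y))\<^sup>2) ` S)" by (rule bdd_belowI[of _ 0]) auto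
  have D_le: "D \<le> (norm (x - y))\<^sup>2" if "y \<in> S" for y
    unfolding D_def using bdd that by (rule cINF_lower)
  have "\<exists>y\<in>S. (norm (x - y))\<^sup>2 < D + 1 / real (Suc n)" for n
    using cINF_less_iff[OF _ bdd, of "D + 1 / real (Suc n)"] subspace_0[OF S]
    unfolding D_def[symmetric] by force
  then obtain y where y: "\<And>n. y n \<in> S" "\<And>n. (norm (x - y n))\<^sup>2 < D + 1 / real (Suc n)"
    by metis
  have close: "(norm (y m - y n))\<^sup>2 \<le> 2 / real (Suc m) + 2 / real (Suc n)" for m n
  proof -
    let ?z = "(1/2) *\<^sub>R (y m + y n)"
    \<comment> \<open>Parallelogram law around \<open>x\<close>. The midpoint \<open>?z\<close> lies
      in \<open>S\<close>, so its squared distance is at least \<open>D\<close>, and the multiples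
      of \<open>D\<close> cancel.\<close>
    have "(norm (y m - y n))\<^sup>2
        = 2 * (norm (x - y m))\<^sup>2 + 2 * (norm (x - y n))\<^sup>2 - 4 * (norm (x - ?z))\<^sup>2"
      by (simp add: power2_norm_eq_inner inner_diff_left inner_diff_right inner_add_left
          inner_add_right inner_commute algebra_simps)
    moreover have "?z \<in> S" by (intro subspace_add subspace_scale S y(1))
    ultimately show ?thesis using D_le[of ?z] y(2)[of m] y(2)[of n] by simp
  qed
  have "Cauchy y"
  proof (rule metric_CauchyI)
    fix e :: real assume e: "0 < e"
    obtain N where N: "4 / e\<^sup>2 < real (Suc N)"
      using reals_Archimedean2 by (metis lessI less_trans of_nat_less_iff)
    have "dist (y m) (y n) < e" if "N \<le> m" "N \<le> n" for m n
    proof -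
      have "(norm (y m - y n))\<^sup>2 \<le> 2 / real (Suc N) + 2 / real (Suc N)"
        using that by (intro order_trans[OF close] add_mono divide_left_mono) auto
      also have "\<dots> = 4 / real (Suc N)" by simp
      also have "\<dots> < e\<^sup>2" using N e by (simp add: field_simps)
      finally show ?thesis using e by (simp add: dist_norm power_less_imp_less_base)
    qed
    then show "\<exists>N. \<forall>m\<ge>N. \<forall>n\<ge>N. dist (y m) (y n) < e" by blast
  qed
  then obtain p where p: "p \<in> S" "y \<longlonglongrightarrow> p" using comp y(1) completeE by metis
  have "(norm (x - p))\<^sup>2 \<le> D + 0"
  proof (rule LIMSEQ_le)
    show "(\<lambda>n. (norm (x - y n))\<^sup>2) \<longlonglongrightarrow> (norm (x - p))\<^sup>2" by (intro tendsto_intros p)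
    show "(\<lambda>n. D + 1 / real (Suc n)) \<longlonglongrightarrow> D + 0"
      by (intro tendsto_add tendsto_const LIMSEQ_Suc[OF lim_1_over_n])
  qed (use y(2) less_imp_le in blast)
  then have min: "(norm (x - p))\<^sup>2 \<le> (norm (x - z))\<^sup>2" if "z \<in> S" for z
    using D_le[OF that] by linarith
  have "s \<bullet> (x - p) = 0" if s: "s \<in> S" for s
  proof (cases "s = 0")
    case False
    define a where "a = s \<bullet> (x - p)"
    \<comment> \<open>This \<open>t\<close> minimizes the change in squared distance when
      \<open>p\<close> moves along \<open>s\<close>. The minimum is
      \<open>- a\<^sup>2 / (s \<bullet> s)\<close>, so minimality of \<open>p\<close> forces
      \<open>a = 0\<close>.\<close>
    define t where "t = a / (s \<bullet> s)"
    have ss: "s \<bullet> s > 0" using False by simp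
    have "p + t *\<^sub>R s \<in> S" by (intro subspace_add subspace_scale S p(1) s)
    from min[OF this] have "(norm (x - p))\<^sup>2 \<le> (norm ((x - p) - t *\<^sub>R s))\<^sup>2"
      by (simp add: algebra_simps)
    also have "\<dots> = (norm (x - p))\<^sup>2 - 2 * t * a + t\<^sup>2 * (s \<bullet> s)"
      unfolding a_def power2_norm_eq_inner
      by (simp only: inner_diff_left[of "x - p"] inner_diff_right[of _ "x - p"]
          inner_commute[of "x - p" "t *\<^sub>R s"]) (simp add: power2_eq_square)
    also have "\<dots> = (norm (x - p))\<^sup>2 - a\<^sup>2 / (s \<bullet> s)"
      using ss by (simp add: t_def power2_eq_square)
    finally have "a\<^sup>2 / (s \<bullet> s) \<le> 0" by simp
    then have "a\<^sup>2 \<le> 0" using ss by (simp add: divide_le_0_iff)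
    then show ?thesis by (simp add: a_def)
  qed simp
  then show "\<exists>p\<in>S. x - p \<in> S\<^sup>\<bottom>" using p(1) by (auto simp: mem_orthogonal_comp_iff)
qed

section \<open>Operators on subspaces\<close>

lemma bounded_linear_on_onorm_le:
  assumes "bounded_linear_on S f" "x \<in> S"
  shows "norm (f x) \<le> onorm_on S f * norm x"
proof -
  obtain K where K: "\<And>x. x \<in> S \<Longrightarrow> norm (f x) \<le> norm x * K"
    using assms(1) unfolding bounded_linear_on_def by blast
  \<comment> \<open>At \<open>z = 0\<close> the quotient is 0 by convention, which a negative
    \<open>K\<close> would not bound; hence the absolute value.\<close>
  have "norm (f z) / norm z \<le> \<bar>K\<bar>" if "z \<in> S" for z
  proof (cases "z = 0")
    case False
    then have "norm (f z) / norm z \<le> K"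
      using K[OF that] by (simp add: pos_divide_le_eq mult.commute)
    then show ?thesis by simp
  qed simp
  then have "bdd_above ((\<lambda>z. norm (f z) / norm z) ` S)"
    unfolding bdd_above_def by blast
  then have "norm (f x) / norm x \<le> onorm_on S f"
    unfolding onorm_on_def using assms(2) by (intro cSUP_upper)
  then show ?thesis using K[OF assms(2)] by (cases "x = 0") (auto simp: pos_divide_le_eq)
qed

lemma onorm_on_le:
  assumes "S \<noteq> {}" "0 \<le> K" "\<And>x. x \<in> S \<Longrightarrow> norm (f x) \<le> K * norm x"
  shows "onorm_on S f \<le> K"
  unfolding onorm_on_def
proof (rule cSUP_least)
  fix x assume "x \<in> S"
  then show "norm (f x) / norm x \<le> K"
    using assms by (cases "x = 0") (auto simp: pos_divide_le_eq)
qed (fact assms(1))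

lemma bounded_linear_on_add:
  assumes "bounded_linear_on S f" "x \<in> S" "y \<in> S"
  shows "f (x + y) = f x + f y"
  using assms by (simp add: bounded_linear_on_def)

lemma bounded_linear_on_scaleR:
  assumes "bounded_linear_on S f" "x \<in> S"
  shows "f (r *\<^sub>R x) = r *\<^sub>R f x"
  using assms by (simp add: bounded_linear_on_def)

lemma bounded_linear_on_0:
  assumes "bounded_linear_on S f" "0 \<in> S"
  shows "f 0 = 0"
  using bounded_linear_on_scaleR[OF assms, of 0] by simp

lemma bounded_linear_on_diff:
  assumes "bounded_linear_on S f" "subspace S" "x \<in> S" "y \<in> S"
  shows "f (x - y) = f x - f y"
  using bounded_linear_on_add[OF assms(1,3), of "- y"]
    bounded_linear_on_scaleR[OF assms(1,4), of "- 1"] subspace_neg[OF assms(2,4)]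
  by simp

lemma bounded_linear_on_subset:
  assumes "bounded_linear_on S f" "T \<subseteq> S"
  shows "bounded_linear_on T f"
  using assms unfolding bounded_linear_on_def by (meson subsetD)

lemma subspace_kernel_on:
  assumes "bounded_linear_on S f" "subspace S"
  shows "subspace {x \<in> S. f x = 0}"
  using assms(2) bounded_linear_on_0[OF assms(1)]
  by (auto simp: subspace_def bounded_linear_on_add[OF assms(1)] bounded_linear_on_scaleR[OF assms(1)])

lemma subspace_image_on:
  assumes f: "bounded_linear_on S f" and S: "subspace S"
  shows "subspace (f ` S)"
proof (rule subspaceI)
  show "0 \<in> f ` S" using bounded_linear_on_0[OF f] subspace_0[OF S] by (metis imageI)
  show "x + y \<in> f ` S" if "x \<in> f ` S" "y \<in> f ` S" for x y
    using that bounded_linear_on_add[OF f] subspace_add[OF S] by (smt (verit) image_iff)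
  show "r *\<^sub>R x \<in> f ` S" if "x \<in> f ` S" for r x
    using that bounded_linear_on_scaleR[OF f] subspace_scale[OF S] by (smt (verit) image_iff)
qed

text \<open>If zeros \<open>s n\<close> of \<open>f\<close> converge to \<open>l\<close>, then
  \<open>f l = f (l - s n)\<close>, which boundedness makes arbitrarily small.\<close>

lemma complete_kernel_on:
  assumes f: "bounded_linear_on S f" and S: "subspace S" and comp: "complete S"
  shows "complete {x \<in> S. f x = 0}"
  unfolding complete_def
proof (intro allI impI)
  fix s assume s: "(\<forall>n. s n \<in> {x \<in> S. f x = 0}) \<and> Cauchy s"
  then obtain l where l: "l \<in> S" "s \<longlonglongrightarrow> l" using comp completeE by (metis (no_types, lifting) mem_Collect_eq)
  have "norm (f l) \<le> 0"
  proof (rule LIMSEQ_le)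
    show "(\<lambda>n. norm (f l)) \<longlonglongrightarrow> norm (f l)" by simp
    have "(\<lambda>n. onorm_on S f * norm (l - s n)) \<longlonglongrightarrow> onorm_on S f * norm (l - l)"
      by (intro tendsto_intros l)
    then show "(\<lambda>n. onorm_on S f * norm (l - s n)) \<longlonglongrightarrow> 0" by simp
    have "norm (f l) \<le> onorm_on S f * norm (l - s n)" for n
      using s l bounded_linear_on_onorm_le[OF f, of "l - s n"] bounded_linear_on_diff[OF f S, of l "s n"]
        subspace_diff[OF S] by auto
    then show "\<exists>N. \<forall>n\<ge>N. norm (f l) \<le> onorm_on S f * norm (l - s n)" by blast
  qed
  then show "\<exists>l\<in>{x \<in> S. f x = 0}. s \<longlonglongrightarrow> l" using l by auto
qed

lemma closed_orthogonal_comp: "closed (S\<^sup>\<bottom>)"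
proof -
  have "S\<^sup>\<bottom> = (\<Inter>y\<in>S. {x. y \<bullet> x = 0})" by (auto simp: mem_orthogonal_comp_iff)
  then show ?thesis by (auto intro: closed_hyperplane)
qed

text \<open>The operator \<open>L\<close> is the Moore-Penrose inverse of \<open>f\<close> on \<open>U\<close>.\<close>

lemma orthogonal_left_inverse:
  fixes f :: "'a::real_inner \<Rightarrow> 'b::real_inner"
  assumes U: "subspace U" and f: "bounded_linear_on U f" and im: "orth_complemented (f ` U)"
    and below: "\<And>u. u \<in> U \<Longrightarrow> norm u \<le> c * norm (f u)"
  obtains L where "linear L" "\<And>x. L x \<in> U" "\<And>x. f (L x) = orth_proj (f ` U) x"
    "\<And>u. u \<in> U \<Longrightarrow> L (f u) = u" "\<And>x. norm (L x) \<le> \<bar>c\<bar> * norm x"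
    "\<And>x. x \<in> (f ` U)\<^sup>\<bottom> \<Longrightarrow> L x = 0"
proof
  have sub: "subspace (f ` U)" using im by (simp add: orth_complemented_def)
  have inj: "inj_on f U"
  proof (rule inj_onI)
    fix u v assume uv: "u \<in> U" "v \<in> U" "f u = f v"
    then have "norm (u - v) \<le> 0"
      using below[of "u - v"] subspace_diff[OF U] bounded_linear_on_diff[OF f U] by simp
    then show "u = v" by simp
  qed
  define L where "L = inv_into U f \<circ> orth_proj (f ` U)"
  show LU: "L x \<in> U" and fL: "f (L x) = orth_proj (f ` U) x" for x
    using orth_proj_in[OF im] by (simp_all add: L_def inv_into_into f_inv_into_f)
  show left: "L (f u) = u" if "u \<in> U" for u
    using that inj by (simp add: L_def orth_proj_id[OF sub])
  \<comment> \<open>Since \<open>f\<close> is injective on \<open>U\<close>, a candidate for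
    \<open>L x\<close> is verified by applying \<open>f\<close>. Linearity and vanishing of
    \<open>L\<close> thus follow from those of the projection.\<close>
  have L_eqI: "L x = u" if "u \<in> U" "f u = orth_proj (f ` U) x" for u x
    using inj that LU fL by (metis inj_onD)
  show "linear L"
    using U LU fL linear_orth_proj[OF im]
    by (intro linearI L_eqI)
      (auto simp: subspace_add subspace_scale bounded_linear_on_add[OF f]
        bounded_linear_on_scaleR[OF f] linear_add linear_scale)
  show "norm (L x) \<le> \<bar>c\<bar> * norm x" for x
  proof -
    have "norm (L x) \<le> c * norm (f (L x))" using below LU by blast
    \<comment> \<open>A negative \<open>c\<close> can occur when \<open>U\<close> is zero; the
      absolute value makes the product monotone.\<close>
    also have "\<dots> \<le> \<bar>c\<bar> * norm x"
      using norm_orth_proj_le[OF im] fL by (intro mult_mono) auto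
    finally show ?thesis .
  qed
  show "L x = 0" if "x \<in> (f ` U)\<^sup>\<bottom>" for x
    using that subspace_0[OF U] bounded_linear_on_0[OF f] orth_proj_comp[OF sub]
    by (intro L_eqI) auto
qed

section \<open>The cochain projection\<close>

text \<open>The cocycles are complete as the kernel of a bounded map, and an orthogonal complement
  is closed, so the projection theorem applies to their intersection.\<close>

lemma orth_complemented_harmonics:
  assumes "bounded_closed_hilbert_complex d V"
  shows "orth_complemented (harmonics d V k)"
proof (rule orth_complemented_complete)
  have V: "subspace (V k)" "complete (V k)" "bounded_linear_on (V k) (d k)"
    using assms by (auto simp: bounded_closed_hilbert_complex_def)
  then have Z: "subspace (cocycles d V k)" "complete (cocycles d V k)"
    using subspace_kernel_on complete_kernel_on unfolding cocycles_def by blast+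
  show "subspace (harmonics d V k)"
    unfolding harmonics_def using Z(1) subspace_orthogonal_comp by (rule subspace_inter)
  have "closed (harmonics d V k)"
    unfolding harmonics_def
    by (intro closed_Int complete_imp_closed Z(2) closed_orthogonal_comp)
  then show "complete (harmonics d V k)"
    using Z(2) complete_closed_subset unfolding harmonics_def by blast
qed

text \<open>The constant adds the bound \<open>\<bar>c1\<bar> * \<bar>M\<bar>\<close> for
  \<open>Q\<close> to the product of the bounds \<open>1 + \<bar>c2\<bar>\<close> for the sum of the
  projection onto \<open>Bh\<close> and \<open>R\<close>, and
  \<open>1 + \<bar>c1\<bar> * \<bar>M\<bar>\<close> for the identity minus \<open>Q\<close>.\<close>

lemma bounded_cochain_projection_exists:
  fixes d :: "int \<Rightarrow> 'a \<Rightarrow> 'a::real_inner"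
  assumes V: "bounded_closed_hilbert_complex d V"
    and M: "\<And>k. onorm_on (V k) (d k) \<le> M"
    and Vh: "finite_dim_subcomplex d V Vh"
    and c1: "\<And>k v. v \<in> cocycles_perp d Vh k \<Longrightarrow> norm v \<le> c1 * norm (d k v)"
    and c2: "\<And>k q. q \<in> harmonics d Vh k \<Longrightarrow> norm q \<le> c2 * norm (orth_proj (harmonics d V k) q)"
  shows "\<exists>\<pi>. bounded_cochain_projection d V Vh \<pi> \<and>
    (\<forall>k. onorm_on (V k) (\<pi> k) \<le> \<bar>c1\<bar> * \<bar>M\<bar> + (1 + \<bar>c2\<bar>) * (1 + \<bar>c1\<bar> * \<bar>M\<bar>))"
proof -
  have subV: "subspace (V k)" and dV: "bounded_linear_on (V k) (d k)"
    and d_in: "v \<in> V k \<Longrightarrow> d k v \<in> V (k + 1)"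
    and dd: "v \<in> V k \<Longrightarrow> d (k + 1) (d k v) = 0" for k v
    using V unfolding bounded_closed_hilbert_complex_def by blast+
  have fin: "\<exists>B. finite B \<and> span B = Vh k" and Vh_V: "Vh k \<subseteq> V k"
    and dh_in: "v \<in> Vh k \<Longrightarrow> d k v \<in> Vh (k + 1)" for k v
    using Vh unfolding finite_dim_subcomplex_def by blast+
  have subVh: "subspace (Vh k)" for k using fin subspace_span by metis
  have dVh: "bounded_linear_on (Vh k) (d k)" for k
    using dV Vh_V bounded_linear_on_subset by blast
  have d0: "d k 0 = 0" for k using bounded_linear_on_0[OF dV] subspace_0[OF subV] .
  have d_le: "norm (d k v) \<le> \<bar>M\<bar> * norm v" if "v \<in> V k" for k v
  proof -
    have "norm (d k v) \<le> onorm_on (V k) (d k) * norm v"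
      using dV that by (rule bounded_linear_on_onorm_le)
    also have "\<dots> \<le> \<bar>M\<bar> * norm v"
      using M[of k] by (intro mult_right_mono) auto
    finally show ?thesis .
  qed

  \<comment> \<open>The discrete spaces\<close>
  define Zh where "Zh = cocycles d Vh"
  define Bh where "Bh = coboundaries d Vh"
  define Hh where "Hh = harmonics d Vh"
  define U where "U = cocycles_perp d Vh"
  define H where "H = harmonics d V"
  define P where "P k = orth_proj (H k)" for k

  have Bh_Suc: "Bh (k + 1) = d k ` Vh k" for k
    by (simp add: Bh_def coboundaries_def)
  have fd: "\<exists>B. finite B \<and> span B = S" if "subspace S" "S \<subseteq> Vh k" for S k
    using subspace_finite_span[OF that(1)] that(2) fin by metis
  have oc: "orth_complemented S" if "subspace S" "S \<subseteq> Vh k" for S k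
    using fd[OF that] orth_complemented_span by metis
  have subZh: "subspace (Zh k)" for k
    unfolding Zh_def cocycles_def using dVh subVh by (rule subspace_kernel_on)
  have Zh_Vh: "Zh k \<subseteq> Vh k" for k by (auto simp: Zh_def cocycles_def)
  have dZh: "d k z = 0" if "z \<in> Zh k" for k z using that by (simp add: Zh_def cocycles_def)
  have Bh_Zh: "Bh k \<subseteq> Zh k" for k
    using dh_in[of _ "k - 1"] dd[of _ "k - 1"] Vh_V[of "k - 1"]
    by (auto simp: Bh_def coboundaries_def Zh_def cocycles_def)
  have subBh: "subspace (Bh k)" for k
    unfolding Bh_def coboundaries_def using dVh subVh by (rule subspace_image_on)
  have ocBh: "orth_complemented (Bh k)" for k
    using oc[OF subBh] Bh_Zh Zh_Vh by blast
  have Hh_Zh: "Hh k \<subseteq> Zh k" for k by (auto simp: Hh_def harmonics_def Zh_def)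
  have subHh: "subspace (Hh k)" for k
    unfolding Hh_def harmonics_def using subZh[unfolded Zh_def] subspace_orthogonal_comp
    by (rule subspace_inter)
  have subU: "subspace (U k)" for k
    unfolding U_def cocycles_perp_def using subVh subspace_orthogonal_comp by (rule subspace_inter)
  have U_Vh: "U k \<subseteq> Vh k" for k by (auto simp: U_def cocycles_perp_def)
  have dU: "d k ` U k = Bh (k + 1)" for k
  proof
    show "Bh (k + 1) \<subseteq> d k ` U k"
    proof
      fix b assume "b \<in> Bh (k + 1)"
      then obtain v where v: "v \<in> Vh k" "b = d k v" unfolding Bh_Suc by blast
      \<comment> \<open>Removing the cocycle part of \<open>v\<close> leaves \<open>d k v\<close>
        unchanged and lands in \<open>U k\<close>, so \<open>d\<close> maps \<open>U k\<close> onto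
        all discrete coboundaries.\<close>
      let ?z = "orth_proj (Zh k) v"
      have z: "?z \<in> Zh k" "v - ?z \<in> (Zh k)\<^sup>\<bottom>"
        using orth_proj[OF oc[OF subZh Zh_Vh]] by blast+
      moreover have "v - ?z \<in> Vh k"
        using v(1) z(1) Zh_Vh by (intro subspace_diff[OF subVh]) blast+
      ultimately have "v - ?z \<in> U k"
        by (auto simp: U_def cocycles_perp_def Zh_def)
      moreover have "d k (v - ?z) = b"
        using z(1) v Zh_Vh dZh by (subst bounded_linear_on_diff[OF dVh subVh]) auto
      ultimately show "b \<in> d k ` U k" by blast
    qed
  qed (use U_Vh Bh_Suc in blast)

  \<comment> \<open>The discrete inverse of \<open>d\<close>\<close>
  have "\<exists>L. linear L \<and> (\<forall>x. L x \<in> U k) \<and> (\<forall>x. d k (L x) = orth_proj (Bh (k + 1)) x)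
      \<and> (\<forall>x. norm (L x) \<le> \<bar>c1\<bar> * norm x)" for k
  proof -
    have "bounded_linear_on (U k) (d k)" using dVh U_Vh by (rule bounded_linear_on_subset)
    moreover have "orth_complemented (d k ` U k)" unfolding dU by (rule ocBh)
    \<comment> \<open>The hypothesis on \<open>c1\<close> is exactly the lower bound that inverting
      \<open>d\<close> on \<open>U k\<close> requires.\<close>
    ultimately show ?thesis
      using c1 by (rule orthogonal_left_inverse[OF subU[of k], of "d k" c1])
        (auto simp: U_def[symmetric] dU)
  qed
  then obtain G where linG: "\<And>k. linear (G k)" and G_U: "\<And>k x. G k x \<in> U k"
    and dG: "\<And>k x. d k (G k x) = orth_proj (Bh (k + 1)) x"
    and G_le: "\<And>k x. norm (G k x) \<le> \<bar>c1\<bar> * norm x"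
    by metis

  \<comment> \<open>Lifting harmonic forms to discrete harmonic forms\<close>
  have ocH: "orth_complemented (H k)" for k
    unfolding H_def using V by (rule orth_complemented_harmonics)
  have linP: "linear (P k)" and P_H: "P k x \<in> H k" and P_comp: "x - P k x \<in> (H k)\<^sup>\<bottom>"
    and P_le: "norm (P k x) \<le> norm x" for k x
    unfolding P_def
    using linear_orth_proj[OF ocH] orth_proj[OF ocH] norm_orth_proj_le[OF ocH] by auto
  have "\<exists>L. linear L \<and> (\<forall>x. L x \<in> Hh k) \<and> (\<forall>q\<in>Hh k. L (P k q) = q)
      \<and> (\<forall>x. norm (L x) \<le> \<bar>c2\<bar> * norm x) \<and> (\<forall>x\<in>(P k ` Hh k)\<^sup>\<bottom>. L x = 0)" for k
  proof -
    have "bounded_linear_on (Hh k) (P k)"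
      unfolding bounded_linear_on_def
      using linP P_le by (auto simp: linear_add linear_scale intro!: exI[of _ 1])
    moreover have "orth_complemented (P k ` Hh k)"
    proof -
      \<comment> \<open>\<open>H k\<close> may be infinite-dimensional, but the image of
        \<open>Hh k\<close> is spanned by the images of a finite spanning set.\<close>
      obtain B where B: "finite B" "span B = Hh k"
        using fd[OF subHh] Hh_Zh Zh_Vh by (metis order_trans)
      then show ?thesis
        using orth_complemented_span[of "P k ` B"] linear_span_image[OF linP] by auto
    qed
    moreover have "norm q \<le> c2 * norm (P k q)" if "q \<in> Hh k" for q
      using c2 that by (simp add: Hh_def P_def H_def)
    ultimately show ?thesis
      by (rule orthogonal_left_inverse[OF subHh[of k], of "P k" c2]) blast+
  qed
  then obtain R where linR: "\<And>k. linear (R k)" and R_Hh: "\<And>k x. R k x \<in> Hh k"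
    and R_P: "\<And>k q. q \<in> Hh k \<Longrightarrow> R k (P k q) = q"
    and R_le: "\<And>k x. norm (R k x) \<le> \<bar>c2\<bar> * norm x"
    and R_comp: "\<And>k x. x \<in> (P k ` Hh k)\<^sup>\<bottom> \<Longrightarrow> R k x = 0"
    by metis
  have R_comp_H: "R k x = 0" if "x \<in> (H k)\<^sup>\<bottom>" for k x
    using that P_H orthogonal_comp_anti_mono[of "P k ` Hh k" "H k"] by (intro R_comp) blast
  \<comment> \<open>Continuous coboundaries are orthogonal to the harmonic forms, and
    \<open>R\<close> sees only the harmonic component. Commutation with \<open>d\<close> rests on
    this.\<close>
  have R_d: "R (k + 1) (d k v) = 0" if "v \<in> V k" for k v
    using that by (intro R_comp_H)
      (auto simp: H_def harmonics_def coboundaries_def mem_orthogonal_comp_iff inner_commute)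
  have R_Bh: "R k b = 0" if "b \<in> Bh k" for k b
    using that R_d[of _ "k - 1"] Vh_V[of "k - 1"] by (auto simp: Bh_def coboundaries_def)
  \<comment> \<open>\<open>R\<close> inverts \<open>P\<close> only on \<open>P k q\<close>, but the
    remainder \<open>q - P k q\<close> is orthogonal to \<open>H k\<close> and is killed.\<close>
  have R_id: "R k q = q" if "q \<in> Hh k" for k q
  proof -
    have "R k q = R k (P k q) + R k (q - P k q)" by (simp add: linear_diff[OF linR])
    then show ?thesis using R_P[OF that] R_comp_H[OF P_comp] by simp
  qed

  \<comment> \<open>A projection onto the discrete cocycles, in general not orthogonal\<close>
  define E where "E k x = orth_proj (Bh k) x + R k x" for k x
  have linE: "linear (E k)" for k
    unfolding E_def using linear_orth_proj[OF ocBh] linR by (intro linear_compose_add)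
  have E_Zh: "E k x \<in> Zh k" for k x
    unfolding E_def using orth_proj_in[OF ocBh] R_Hh Bh_Zh Hh_Zh
    by (intro subspace_add[OF subZh]) blast+
  have E_le: "norm (E k x) \<le> (1 + \<bar>c2\<bar>) * norm x" for k x
    unfolding E_def using norm_orth_proj_le[OF ocBh] R_le
    by (intro norm_triangle_le) (simp add: distrib_right add_mono)
  \<comment> \<open>Discrete Hodge decomposition: \<open>?b\<close> is the coboundary part of
    \<open>z\<close> and \<open>z - ?b\<close> is discretely harmonic; \<open>R\<close> kills the
    former and fixes the latter.\<close>
  have E_id: "E k z = z" if "z \<in> Zh k" for k z
  proof -
    let ?b = "orth_proj (Bh k) z"
    have b: "?b \<in> Bh k" "z - ?b \<in> (Bh k)\<^sup>\<bottom>" using orth_proj[OF ocBh] by blast+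
    moreover have "z - ?b \<in> Zh k"
      using that b(1) Bh_Zh by (intro subspace_diff[OF subZh]) blast+
    ultimately have "z - ?b \<in> Hh k" by (auto simp: Hh_def harmonics_def Bh_def Zh_def)
    then have "R k z - R k ?b = z - ?b" using R_id linear_diff[OF linR] by metis
    then show ?thesis using R_Bh[OF b(1)] by (simp add: E_def)
  qed

  \<comment> \<open>Assembling the cochain projection\<close>
  define Q where "Q k v = G k (d k v)" for k v
  define \<pi> where "\<pi> k v = Q k v + E k (v - Q k v)" for k v
  have Q_Vh: "Q k v \<in> Vh k" for k v using G_U U_Vh by (auto simp: Q_def)
  have Q_le: "norm (Q k v) \<le> \<bar>c1\<bar> * \<bar>M\<bar> * norm v" if "v \<in> V k" for k v
    using order_trans[OF G_le mult_left_mono[OF d_le[OF that] abs_ge_zero]]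
    by (simp add: Q_def mult.assoc)
  have \<pi>_Vh: "\<pi> k v \<in> Vh k" for k v
    unfolding \<pi>_def using Q_Vh E_Zh Zh_Vh by (intro subspace_add[OF subVh]) blast+
  have \<pi>_le: "norm (\<pi> k v) \<le> (\<bar>c1\<bar> * \<bar>M\<bar> + (1 + \<bar>c2\<bar>) * (1 + \<bar>c1\<bar> * \<bar>M\<bar>)) * norm v"
    if v: "v \<in> V k" for k v
  proof -
    have "norm (v - Q k v) \<le> (1 + \<bar>c1\<bar> * \<bar>M\<bar>) * norm v"
      using norm_triangle_ineq4[of v "Q k v"] Q_le[OF v] by (simp add: distrib_right)
    then have E: "norm (E k (v - Q k v)) \<le> (1 + \<bar>c2\<bar>) * ((1 + \<bar>c1\<bar> * \<bar>M\<bar>) * norm v)"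
      by (intro order_trans[OF E_le] mult_left_mono) auto
    then show ?thesis
      using norm_triangle_mono[OF Q_le[OF v] E]
      by (simp only: \<pi>_def distrib_right[of "\<bar>c1\<bar> * \<bar>M\<bar>"] mult.assoc[of "1 + \<bar>c2\<bar>"])
  qed
  \<comment> \<open>\<open>G\<close> and \<open>E\<close> are linear everywhere, whereas
    \<open>d k\<close> is linear only on \<open>V k\<close>.\<close>
  have \<pi>_add: "\<pi> k (x + y) = \<pi> k x + \<pi> k y" if "x \<in> V k" "y \<in> V k" for k x y
    unfolding \<pi>_def Q_def bounded_linear_on_add[OF dV that] linear_add[OF linG]
      linear_add[OF linE] linear_diff[OF linE] by simp
  have \<pi>_scale: "\<pi> k (r *\<^sub>R x) = r *\<^sub>R \<pi> k x" if "x \<in> V k" for k r x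
    unfolding \<pi>_def Q_def bounded_linear_on_scaleR[OF dV that] linear_scale[OF linG]
      linear_scale[OF linE] linear_diff[OF linE] by (simp add: algebra_simps)
  have "bounded_linear_on (V k) (\<pi> k)" for k
    unfolding bounded_linear_on_def using \<pi>_add \<pi>_scale \<pi>_le by (metis mult.commute)
  moreover have "\<pi> k v = v" if v: "v \<in> Vh k" for k v
  proof -
    \<comment> \<open>For discrete \<open>v\<close>, \<open>d k v\<close> already lies in
      \<open>Bh (k + 1)\<close>, so projecting changes nothing and \<open>v - Q k v\<close> is a
      discrete cocycle, fixed by \<open>E\<close>.\<close>
    have "d k (Q k v) = d k v"
      unfolding Q_def dG using v by (intro orth_proj_id subBh) (simp add: Bh_Suc)
    then have "v - Q k v \<in> Zh k"
      using v Q_Vh subspace_diff[OF subVh] bounded_linear_on_diff[OF dVh subVh]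
      by (simp add: Zh_def cocycles_def)
    then show ?thesis by (simp add: \<pi>_def E_id)
  qed
  moreover have "d k (\<pi> k v) = \<pi> (k + 1) (d k v)" if v: "v \<in> V k" for k v
  proof -
    have "d k (\<pi> k v) = d k (Q k v) + d k (E k (v - Q k v))"
      unfolding \<pi>_def using E_Zh Zh_Vh by (intro bounded_linear_on_add[OF dVh] Q_Vh) blast
    \<comment> \<open>The values of \<open>E\<close> are cocycles, so only the \<open>Q\<close> term
      survives.\<close>
    also have "\<dots> = orth_proj (Bh (k + 1)) (d k v)"
      using dZh[OF E_Zh] by (simp add: Q_def dG)
    \<comment> \<open>On \<open>d k v\<close> the term \<open>Q\<close> vanishes because
      \<open>d\<close> squares to zero, and \<open>R\<close> vanishes on coboundaries; only the
      projection onto \<open>Bh (k + 1)\<close> remains.\<close>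
    also have "\<dots> = \<pi> (k + 1) (d k v)"
      using dd[OF v] R_d[OF v] linear_0[OF linG] by (simp add: \<pi>_def Q_def E_def)
    finally show ?thesis .
  qed
  ultimately have "bounded_cochain_projection d V Vh \<pi>"
    using \<pi>_Vh by (auto simp: bounded_cochain_projection_def)
  moreover have "onorm_on (V k) (\<pi> k) \<le> \<bar>c1\<bar> * \<bar>M\<bar> + (1 + \<bar>c2\<bar>) * (1 + \<bar>c1\<bar> * \<bar>M\<bar>)" for k
    using subspace_0[OF subV, of k] \<pi>_le by (intro onorm_on_le) auto
  ultimately show ?thesis by blast
qed

text \<open>\<open>C\<close> is chosen before the complex and the subcomplex, which makes the bound
  uniform; \<open>M\<close>, a common bound for the differentials, is a fixed parameter. The witness
  is the explicit constant obtained above.\<close>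

theorem theorem3p7:
  fixes M :: real
  shows "\<exists>C :: real \<Rightarrow> real \<Rightarrow> real.
    \<forall>(V :: int \<Rightarrow> 'a::real_inner set) (d :: int \<Rightarrow> 'a \<Rightarrow> 'a) (Vh :: int \<Rightarrow> 'a set) c1 c2.
      bounded_closed_hilbert_complex d V \<longrightarrow>
      (\<forall>k. onorm_on (V k) (d k) \<le> M) \<longrightarrow>
      finite_dim_subcomplex d V Vh \<longrightarrow>
      (\<forall>k. \<forall>v\<in>cocycles_perp d Vh k. norm v \<le> c1 * norm (d k v)) \<longrightarrow>
      (\<forall>k. \<forall>q\<in>harmonics d Vh k. norm q \<le> c2 * norm (orth_proj (harmonics d V k) q)) \<longrightarrow>
      (\<exists>\<pi>. bounded_cochain_projection d V Vh \<pi> \<and>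
           (\<forall>k. onorm_on (V k) (\<pi> k) \<le> C c1 c2))"
  by (intro exI[of _ "\<lambda>c1 c2. \<bar>c1\<bar> * \<bar>M\<bar> + (1 + \<bar>c2\<bar>) * (1 + \<bar>c1\<bar> * \<bar>M\<bar>)"] allI impI
      bounded_cochain_projection_exists) blast+

end
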